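(* For all $k\ge2$, the monoids $\mathsf{tlep}M_{k,1}$, $\mathsf{tlep}\mathcal{RM}^{\mathsf{fin}}$, and $\mathsf{tfl}\mathcal{RM}^{\mathsf{fin}}$ (over an alphabet of size $k$) are not congruence-simple.
   Context: Let $A$ be an alphabet with $|A|=k$. A prefix code in $A^*$ is a set of strings none of which is a proper prefix of another. A right-ideal morphism of $A^*$ is a partial function $f:A^*\to A^*$ whose domain is a right ideal (a set $R$ with $R=RA^*$) and such that $f(xu)=f(x)u$ for all $x\in\mathrm{Dom}(f)$, $u\in A^*$; $\mathrm{domC}(f)$ is the unique prefix code with $\mathrm{Dom}(f)=\mathrm{domC}(f)A^*$. $f$ is tlep (total length-equality preserving) if $\mathrm{domC}(f)$ is a maximal prefix code and for all $x_1,x_2\in\mathrm{Dom}(f)$: $|x_1|=|x_2|$ implies $|f(x_1)|=|f(x_2)|$. $f$ is tfl if it is tlep and $\mathrm{domC}(f)=A^m$ for some $m\ge0$. $\mathsf{tlep}\mathcal{RM}^{\mathsf{fin}}$ and $\mathsf{tfl}\mathcal{RM}^{\mathsf{fin}}$ are the monoids, under composition, of all tlep (respectively tfl) right-ideal morphisms with finite domain code. $f\equiv_{\rm fin}g$ iff the symmetric difference of $\mathrm{Dom}(f)$ and $\mathrm{Dom}(g)$ is finite and $f,g$ agree on $\mathrm{Dom}(f)\cap\mathrm{Dom}(g)$; this is a congruence, and $\mathsf{tlep}M_{k,1}=\mathsf{tlep}\mathcal{RM}^{\mathsf{fin}}/\!\equiv_{\rm fin}$. A monoid is congruence-simple if its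 only congruences are equality and the universal congruence. *)

theory Defs
  imports "HOL-Algebra.Group" "HOL-Library.Sublist"
begin

section \<open>Congruences on monoids\<close>

definition monoid_congruence :: "('m, 'n) monoid_scheme \<Rightarrow> ('m \<times> 'm) set \<Rightarrow> bool" where
  "monoid_congruence M r \<longleftrightarrow> equiv (carrier M) r \<and>
     (\<forall>x x' y y'. (x, x') \<in> r \<longrightarrow> (y, y') \<in> r \<longrightarrow> (x \<otimes>\<^bsub>M\<^esub> y, x' \<otimes>\<^bsub>M\<^esub> y') \<in> r)"

definition congruence_simple :: "('m, 'n) monoid_scheme \<Rightarrow> bool" where
  "congruence_simple M \<longleftrightarrow>
     (\<forall>r. monoid_congruence M r \<longrightarrow> r = Id_on (carrier M) \<or> r = carrier M \<times> carrier M)"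

text \<open>For a congruence \<open>r\<close> the product below is the class of the product of representatives,
  see \<open>quotient_monoid_mult_class\<close>.\<close>

definition quotient_monoid :: "('m, 'n) monoid_scheme \<Rightarrow> ('m \<times> 'm) set \<Rightarrow> 'm set monoid" where
  "quotient_monoid M r =
     \<lparr>carrier = carrier M // r,
      mult = (\<lambda>X Y. \<Union>x\<in>X. \<Union>y\<in>Y. r `` {x \<otimes>\<^bsub>M\<^esub> y}),
      one = r `` {\<one>\<^bsub>M\<^esub>}\<rparr>"

lemma quotient_monoid_mult_class:
  assumes r: "monoid_congruence M r" and x: "x \<in> carrier M" and y: "y \<in> carrier M"
  shows "r `` {x} \<otimes>\<^bsub>quotient_monoid M r\<^esub> r `` {y} = r `` {x \<otimes>\<^bsub>M\<^esub> y}"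
proof -
  have e: "equiv (carrier M) r" using r by (simp add: monoid_congruence_def)
  have eq: "r `` {x' \<otimes>\<^bsub>M\<^esub> y'} = r `` {x \<otimes>\<^bsub>M\<^esub> y}" if xy: "(x, x') \<in> r" "(y, y') \<in> r" for x' y'
  proof -
    have "(x \<otimes>\<^bsub>M\<^esub> y, x' \<otimes>\<^bsub>M\<^esub> y') \<in> r" using r xy unfolding monoid_congruence_def by blast
    from equiv_class_eq[OF e this] show ?thesis by (rule sym)
  qed
  have "x \<in> r `` {x}" "y \<in> r `` {y}"
    using equiv_class_self[OF e] x y by blast+
  then have "(\<Union>x'\<in>r `` {x}. \<Union>y'\<in>r `` {y}. r `` {x' \<otimes>\<^bsub>M\<^esub> y'}) = r `` {x \<otimes>\<^bsub>M\<^esub> y}"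
    using eq by blast
  then show ?thesis by (simp add: quotient_monoid_def)
qed

lemma monoid_quotient_monoid:
  assumes "monoid M" and r: "monoid_congruence M r"
  shows "monoid (quotient_monoid M r)"
proof -
  interpret monoid M by fact
  note mult = quotient_monoid_mult_class[OF r]
  have c: "carrier (quotient_monoid M r) = carrier M // r"
    and o: "\<one>\<^bsub>quotient_monoid M r\<^esub> = r `` {\<one>\<^bsub>M\<^esub>}"
    by (simp_all add: quotient_monoid_def)
  have cl: "\<exists>x\<in>carrier M. X = r `` {x}" if "X \<in> carrier (quotient_monoid M r)" for X
    using that unfolding c by (blast elim: quotientE)
  show ?thesis
  proof (rule monoidI)
    fix X Y assume "X \<in> carrier (quotient_monoid M r)" "Y \<in> carrier (quotient_monoid M r)"
    then obtain x y where "x \<in> carrier M" "X = r `` {x}" "y \<in> carrier M" "Y = r `` {y}"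
      using cl by metis
    then show "X \<otimes>\<^bsub>quotient_monoid M r\<^esub> Y \<in> carrier (quotient_monoid M r)"
      by (simp only: mult c) (rule quotientI[OF m_closed])
  next
    show "\<one>\<^bsub>quotient_monoid M r\<^esub> \<in> carrier (quotient_monoid M r)"
      unfolding c o by (rule quotientI[OF one_closed])
  next
    fix X Y Z
    assume "X \<in> carrier (quotient_monoid M r)" "Y \<in> carrier (quotient_monoid M r)"
      "Z \<in> carrier (quotient_monoid M r)"
    then obtain x y z where "x \<in> carrier M" "X = r `` {x}" "y \<in> carrier M" "Y = r `` {y}"
      "z \<in> carrier M" "Z = r `` {z}"
      using cl by metis
    then show "X \<otimes>\<^bsub>quotient_monoid M r\<^esub> Y \<otimes>\<^bsub>quotient_monoid M r\<^esub> Z =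
        X \<otimes>\<^bsub>quotient_monoid M r\<^esub> (Y \<otimes>\<^bsub>quotient_monoid M r\<^esub> Z)"
      by (simp only: mult m_closed m_assoc)
  next
    fix X assume "X \<in> carrier (quotient_monoid M r)"
    then obtain x where "x \<in> carrier M" "X = r `` {x}" using cl by blast
    then show "\<one>\<^bsub>quotient_monoid M r\<^esub> \<otimes>\<^bsub>quotient_monoid M r\<^esub> X = X"
      and "X \<otimes>\<^bsub>quotient_monoid M r\<^esub> \<one>\<^bsub>quotient_monoid M r\<^esub> = X"
      by (simp_all only: o mult one_closed l_one r_one)
  qed
qed


section \<open>Right-ideal morphisms\<close>

definition conc :: "'a list set \<Rightarrow> 'a list set \<Rightarrow> 'a list set" where
  "conc P Q = {x @ u |x u. x \<in> P \<and> u \<in> Q}"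

definition prefix_code :: "'a set \<Rightarrow> 'a list set \<Rightarrow> bool" where
  "prefix_code A P \<longleftrightarrow> P \<subseteq> lists A \<and> (\<forall>x\<in>P. \<forall>y\<in>P. \<not> strict_prefix x y)"

definition maximal_prefix_code :: "'a set \<Rightarrow> 'a list set \<Rightarrow> bool" where
  "maximal_prefix_code A P \<longleftrightarrow>
     prefix_code A P \<and> (\<forall>Q. prefix_code A Q \<longrightarrow> P \<subseteq> Q \<longrightarrow> Q = P)"

definition right_ideal :: "'a set \<Rightarrow> 'a list set \<Rightarrow> bool" where
  "right_ideal A R \<longleftrightarrow> R \<subseteq> lists A \<and> R = conc R (lists A)"

text \<open>Partial functions \<open>A\<^sup>* \<rightarrow> A\<^sup>*\<close> are maps between lists whose domain and range
  consist of lists over \<open>A\<close>; the composite \<open>f \<circ> g\<close> (first \<open>g\<close>, then \<open>f\<close>) is \<open>f \<circ>\<^sub>m g\<close>.\<close>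

definition right_ideal_morphism :: "'a set \<Rightarrow> ('a list \<rightharpoonup> 'a list) \<Rightarrow> bool" where
  "right_ideal_morphism A f \<longleftrightarrow>
     right_ideal A (dom f) \<and> ran f \<subseteq> lists A \<and>
     (\<forall>x\<in>dom f. \<forall>u\<in>lists A. the (f (x @ u)) = the (f x) @ u)"

text \<open>The prefix code exists and is unique, see \<open>ex1_prefix_code\<close>.\<close>

definition domC :: "'a set \<Rightarrow> ('a list \<rightharpoonup> 'a list) \<Rightarrow> 'a list set" where
  "domC A f = (THE P. prefix_code A P \<and> dom f = conc P (lists A))"

definition tlep :: "'a set \<Rightarrow> ('a list \<rightharpoonup> 'a list) \<Rightarrow> bool" where
  "tlep A f \<longleftrightarrow> right_ideal_morphism A f \<and> maximal_prefix_code A (domC A f) \<and>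
     (\<forall>x\<^sub>1\<in>dom f. \<forall>x\<^sub>2\<in>dom f. length x\<^sub>1 = length x\<^sub>2 \<longrightarrow> length (the (f x\<^sub>1)) = length (the (f x\<^sub>2)))"

definition tfl :: "'a set \<Rightarrow> ('a list \<rightharpoonup> 'a list) \<Rightarrow> bool" where
  "tfl A f \<longleftrightarrow> tlep A f \<and> (\<exists>m. domC A f = {w \<in> lists A. length w = m})"

definition tlepRM_fin :: "'a set \<Rightarrow> ('a list \<rightharpoonup> 'a list) monoid" where
  "tlepRM_fin A =
     \<lparr>carrier = {f. tlep A f \<and> finite (domC A f)}, mult = (\<circ>\<^sub>m), one = Some |` lists A\<rparr>"

definition tflRM_fin :: "'a set \<Rightarrow> ('a list \<rightharpoonup> 'a list) monoid" where
  "tflRM_fin A =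
     \<lparr>carrier = {f. tfl A f \<and> finite (domC A f)}, mult = (\<circ>\<^sub>m), one = Some |` lists A\<rparr>"

definition fin_equiv :: "'a set \<Rightarrow> (('a list \<rightharpoonup> 'a list) \<times> ('a list \<rightharpoonup> 'a list)) set" where
  "fin_equiv A = {(f, g). f \<in> carrier (tlepRM_fin A) \<and> g \<in> carrier (tlepRM_fin A) \<and>
     finite (sym_diff (dom f) (dom g)) \<and> (\<forall>x\<in>dom f \<inter> dom g. f x = g x)}"

definition tlepM :: "'a set \<Rightarrow> ('a list \<rightharpoonup> 'a list) set monoid" where
  "tlepM A = quotient_monoid (tlepRM_fin A) (fin_equiv A)"


section \<open>Well-definedness\<close>

lemma right_idealD:
  assumes "right_ideal A R" "x \<in> R"
  shows "x \<in> lists A" and "u \<in> lists A \<Longrightarrow> x @ u \<in> R"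
  using assms unfolding right_ideal_def conc_def by blast+

lemma right_idealI:
  assumes "R \<subseteq> lists A" "\<And>x u. x \<in> R \<Longrightarrow> u \<in> lists A \<Longrightarrow> x @ u \<in> R"
  shows "right_ideal A R"
proof -
  have "x = x @ []" for x :: "'a list" by simp
  then have "R \<subseteq> conc R (lists A)" unfolding conc_def by blast
  with assms show ?thesis unfolding right_ideal_def conc_def by blast
qed

lemma ex1_prefix_code:
  assumes R: "right_ideal A R"
  shows "\<exists>!P. prefix_code A P \<and> R = conc P (lists A)"
    and "prefix_code A P \<Longrightarrow> R = conc P (lists A) \<Longrightarrow>
           P = {x \<in> R. \<forall>y\<in>R. \<not> strict_prefix y x}"
proof -
  let ?P = "{x \<in> R. \<forall>y\<in>R. \<not> strict_prefix y x}"
  have "\<exists>p\<in>?P. \<exists>u\<in>lists A. x = p @ u" if "x \<in> R" for x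
    using that
  proof (induction x rule: measure_induct_rule[of length])
    case (less x)
    have xA: "x \<in> lists A" using right_idealD(1)[OF R less.prems] .
    show ?case
    proof (cases "x \<in> ?P")
      case True
      then show ?thesis by (intro bexI[of _ x] bexI[of _ "[]"]) auto
    next
      case False
      then obtain y where y: "y \<in> R" "strict_prefix y x" using less.prems by blast
      then obtain v where v: "x = y @ v" by (auto simp: strict_prefix_def prefix_def)
      obtain p u where "p \<in> ?P" "u \<in> lists A" "y = p @ u"
        using less.IH[OF prefix_length_less[OF y(2)] y(1)] by blast
      with v xA show ?thesis by (intro bexI[of _ p] bexI[of _ "u @ v"]) auto
    qed
  qed
  then have ex: "prefix_code A ?P \<and> R = conc ?P (lists A)"
    using right_idealD[OF R] unfolding prefix_code_def conc_def by blast
  have un: "P = ?P" if P: "prefix_code A P" "R = conc P (lists A)" for P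
  proof -
    have PR: "p \<in> R" if "p \<in> P" for p
    proof -
      have "p @ [] \<in> conc P (lists A)" unfolding conc_def using that by blast
      then show ?thesis unfolding P(2) by simp
    qed
    have ex: "\<exists>p\<in>P. prefix p x" if "x \<in> R" for x
      using that unfolding P(2) conc_def by (auto simp: prefix_def)
    have sp: "\<not> strict_prefix p q" if "p \<in> P" "q \<in> P" for p q
      using P(1) that unfolding prefix_code_def by blast
    show ?thesis
    proof (intro Set.set_eqI iffI)
      fix x assume x: "x \<in> P"
      have "\<not> strict_prefix y x" if y: "y \<in> R" for y
      proof
        assume "strict_prefix y x"
        moreover obtain p where "p \<in> P" "prefix p y" using ex[OF y] by blast
        ultimately show False using sp[of p x] x prefix_order.le_less_trans by blast
      qed
      then show "x \<in> ?P" using PR[OF x] by blast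
    next
      fix x assume x: "x \<in> ?P"
      then obtain p where p: "p \<in> P" "prefix p x" using ex by blast
      then have "\<not> strict_prefix p x" using PR x by blast
      then show "x \<in> P" using p by (simp add: strict_prefix_def)
    qed
  qed
  show "\<exists>!P. prefix_code A P \<and> R = conc P (lists A)" using ex un by blast
  show "prefix_code A P \<Longrightarrow> R = conc P (lists A) \<Longrightarrow> P = ?P" by (rule un)
qed

lemma domC:
  assumes "right_ideal_morphism A f"
  shows "prefix_code A (domC A f)" "dom f = conc (domC A f) (lists A)"
  using theI'[OF ex1_prefix_code(1)[of A "dom f"]] assms
  unfolding domC_def right_ideal_morphism_def by blast+

lemma domC_unique:
  assumes "right_ideal_morphism A f" "prefix_code A P" "dom f = conc P (lists A)"
  shows "domC A f = P"
  using ex1_prefix_code(1)[of A "dom f"] domC[OF assms(1)] assms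
  unfolding right_ideal_morphism_def by blast

lemma domC_minimal:
  assumes "right_ideal_morphism A f"
  shows "domC A f = {x \<in> dom f. \<forall>y\<in>dom f. \<not> strict_prefix y x}"
  using ex1_prefix_code(2)[of A "dom f"] domC[OF assms] assms
  unfolding right_ideal_morphism_def by blast

lemma morphismD:
  assumes "right_ideal_morphism A f" "f x = Some y"
  shows "x \<in> lists A" "y \<in> lists A" "u \<in> lists A \<Longrightarrow> f (x @ u) = Some (y @ u)"
proof -
  have x: "x \<in> dom f" using assms by blast
  then show "x \<in> lists A" using assms(1) right_idealD(1) unfolding right_ideal_morphism_def by blast
  show "y \<in> lists A" using assms unfolding right_ideal_morphism_def ran_def by blast
  assume u: "u \<in> lists A"
  then have "x @ u \<in> dom f" using x assms(1) right_idealD(2) unfolding right_ideal_morphism_def by blast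
  moreover have "the (f (x @ u)) = y @ u"
    using assms u x unfolding right_ideal_morphism_def by (metis option.sel)
  ultimately show "f (x @ u) = Some (y @ u)" by (metis domD option.sel)
qed

lemma morphismI:
  assumes "\<And>x y. f x = Some y \<Longrightarrow> x \<in> lists A" "\<And>x y. f x = Some y \<Longrightarrow> y \<in> lists A"
    "\<And>x y u. f x = Some y \<Longrightarrow> u \<in> lists A \<Longrightarrow> f (x @ u) = Some (y @ u)"
  shows "right_ideal_morphism A f"
  unfolding right_ideal_morphism_def
proof (intro conjI ballI)
  show "right_ideal A (dom f)" by (rule right_idealI) (use assms in blast)+
  show "ran f \<subseteq> lists A" using assms(2) unfolding ran_def by blast
  show "the (f (x @ u)) = the (f x) @ u" if "x \<in> dom f" "u \<in> lists A" for x u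
    using that assms(3) by fastforce
qed

lemma lists_extend:
  assumes "A \<noteq> {}"
  shows "\<exists>u\<in>lists A. length u = n"
proof -
  obtain a where "a \<in> A" using assms by blast
  then show ?thesis by (intro bexI[of _ "replicate n a"]) (auto simp: in_lists_conv_set)
qed

lemma finite_maximal_iff:
  assumes fin: "finite A" and ne: "A \<noteq> {}" and f: "right_ideal_morphism A f"
  shows "maximal_prefix_code A (domC A f) \<and> finite (domC A f) \<longleftrightarrow>
         (\<exists>n. \<forall>x\<in>lists A. n \<le> length x \<longrightarrow> x \<in> dom f)" (is "?L \<longleftrightarrow> ?R")
proof
  note d = domC[OF f]
  assume L: ?L
  define n where "n = Max (insert 0 (length ` domC A f))"
  have n: "length p \<le> n" if "p \<in> domC A f" for p using L that by (auto simp: n_def)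
  have "x \<in> dom f" if x: "x \<in> lists A" "n \<le> length x" for x
  proof -
    have "\<exists>p\<in>domC A f. prefix p x \<or> prefix x p"
    proof (rule ccontr)
      assume no: "\<not> ?thesis"
      then have "prefix_code A (insert x (domC A f))"
        using d(1) x unfolding prefix_code_def by (auto dest: prefix_order.less_imp_le)
      then have "insert x (domC A f) = domC A f"
        using L unfolding maximal_prefix_code_def by blast
      with no show False by blast
    qed
    then obtain p where p: "p \<in> domC A f" "prefix p x \<or> prefix x p" by blast
    have "prefix p x"
      using p(2)
    proof
      assume "prefix x p"
      then obtain v where "p = x @ v" by (auto simp: prefix_def)
      moreover from this have "length p = length x + length v" by simp
      then have "length v = 0" using n[OF p(1)] x(2) by linarith
      ultimately show ?thesis by simp
    qed
    then obtain u where u: "x = p @ u" by (auto simp: prefix_def)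
    then show ?thesis using p(1) x(1) unfolding d(2) conc_def by auto
  qed
  then show ?R by blast
next
  note d = domC[OF f]
  assume ?R
  then obtain n where n: "\<And>x. x \<in> lists A \<Longrightarrow> n \<le> length x \<Longrightarrow> x \<in> dom f" by blast
  have "domC A f \<subseteq> {x. set x \<subseteq> A \<and> length x \<le> n}"
  proof
    fix x assume x: "x \<in> domC A f"
    then have xA: "x \<in> lists A" using d(1) unfolding prefix_code_def by blast
    have "\<not> n < length x"
    proof
      assume l: "n < length x"
      have "take n x \<in> dom f" using l xA by (intro n) (auto dest: in_set_takeD)
      moreover have "strict_prefix (take n x) x"
        using l length_take[of n x] by (auto simp: strict_prefix_def take_is_prefix)
      ultimately show False using x unfolding domC_minimal[OF f] by blast
    qed
    with xA show "x \<in> {x. set x \<subseteq> A \<and> length x \<le> n}" by auto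
  qed
  then have "finite (domC A f)" by (rule finite_subset) (rule finite_lists_length_le[OF fin])
  moreover have "Q = domC A f" if Q: "prefix_code A Q" "domC A f \<subseteq> Q" for Q
  proof (intro Set.set_eqI iffI)
    fix x assume x: "x \<in> Q"
    then have xA: "x \<in> lists A" using Q(1) unfolding prefix_code_def by blast
    obtain u where u: "u \<in> lists A" "length u = n" using lists_extend[OF ne] by blast
    then have "x @ u \<in> dom f" using xA by (intro n) auto
    then obtain p where p: "p \<in> domC A f" "prefix p (x @ u)"
      unfolding d(2) conc_def by (auto simp: prefix_def)
    then have "prefix p x \<or> prefix x p" by (meson prefix_same_cases prefixI)
    moreover have "\<not> strict_prefix p x" "\<not> strict_prefix x p"
      using Q x p(1) unfolding prefix_code_def by blast+
    ultimately show "x \<in> domC A f" using p(1) by (metis prefix_order.le_less)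
  qed (use Q in blast)
  ultimately show ?L using d(1) unfolding maximal_prefix_code_def by blast
qed

lemma tlep_carrier_iff:
  assumes "finite A" "A \<noteq> {}"
  shows "f \<in> carrier (tlepRM_fin A) \<longleftrightarrow>
    right_ideal_morphism A f \<and> (\<exists>n. \<forall>x\<in>lists A. n \<le> length x \<longrightarrow> x \<in> dom f) \<and>
    (\<forall>x y x' y'. f x = Some y \<longrightarrow> f x' = Some y' \<longrightarrow> length x = length x' \<longrightarrow> length y = length y')"
proof -
  have "(\<forall>x\<in>dom f. \<forall>x'\<in>dom f. length x = length x' \<longrightarrow> length (the (f x)) = length (the (f x'))) \<longleftrightarrow>
    (\<forall>x y x' y'. f x = Some y \<longrightarrow> f x' = Some y' \<longrightarrow> length x = length x' \<longrightarrow> length y = length y')"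
    (is "?P \<longleftrightarrow> ?Q")
  proof
    assume ?P
    then show ?Q by (metis domI option.sel)
  next
    assume Q: ?Q
    show ?P
    proof (intro ballI impI)
      fix x x' assume "x \<in> dom f" "x' \<in> dom f" and l: "length x = length x'"
      then obtain y y' where y: "f x = Some y" "f x' = Some y'" by blast
      then have "length y = length y'" using Q l by blast
      then show "length (the (f x)) = length (the (f x'))" by (simp add: y)
    qed
  qed
  moreover have "f \<in> carrier (tlepRM_fin A) \<longleftrightarrow> tlep A f \<and> finite (domC A f)"
    by (simp add: tlepRM_fin_def)
  ultimately show ?thesis
    using finite_maximal_iff[OF assms, of f] unfolding tlep_def by blast
qed

lemma domC_fixed_length_iff:
  assumes f: "right_ideal_morphism A f"
  shows "domC A f = {w \<in> lists A. length w = m} \<longleftrightarrow>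
         dom f = {w \<in> lists A. m \<le> length w}" (is "_ = ?P \<longleftrightarrow> _ = ?D")
proof -
  have c: "conc ?P (lists A) = ?D"
  proof (intro Set.set_eqI iffI)
    fix x assume "x \<in> ?D"
    then have "x = take m x @ drop m x" "take m x \<in> ?P" "drop m x \<in> lists A"
      by (auto dest: in_set_takeD in_set_dropD)
    then show "x \<in> conc ?P (lists A)" unfolding conc_def by blast
  qed (auto simp: conc_def)
  have "prefix_code A ?P" by (auto simp: prefix_code_def dest: prefix_length_less)
  then show ?thesis using domC_unique[OF f] domC(2)[OF f] c by metis
qed

lemma tfl_carrier_iff:
  assumes "finite A" "A \<noteq> {}"
  shows "f \<in> carrier (tflRM_fin A) \<longleftrightarrow>
    f \<in> carrier (tlepRM_fin A) \<and> (\<exists>m. dom f = {w \<in> lists A. m \<le> length w})"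
  by (auto simp: tflRM_fin_def tlepRM_fin_def tfl_def tlep_def domC_fixed_length_iff)

lemma morphism_comp:
  assumes f: "right_ideal_morphism A f" and g: "right_ideal_morphism A g"
  shows "right_ideal_morphism A (f \<circ>\<^sub>m g)"
  by (rule morphismI)
    (auto simp: map_comp_Some_iff dest: morphismD[OF f] morphismD[OF g])

lemma eventually_long:
  assumes "finite A" "A \<noteq> {}" and g: "g \<in> carrier (tlepRM_fin A)"
  shows "\<exists>n. \<forall>x\<in>lists A. n \<le> length x \<longrightarrow> (\<exists>y\<in>lists A. g x = Some y \<and> m \<le> length y)"
proof -
  have gm: "right_ideal_morphism A g" using g tlep_carrier_iff assms(1,2) by blast
  obtain n where n: "\<And>x. x \<in> lists A \<Longrightarrow> n \<le> length x \<Longrightarrow> x \<in> dom g"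
    using g tlep_carrier_iff assms(1,2) by metis
  have "\<exists>y\<in>lists A. g x = Some y \<and> m \<le> length y" if x: "x \<in> lists A" "n + m \<le> length x" for x
  proof -
    have "take n x \<in> dom g" using x by (intro n) (auto dest: in_set_takeD)
    then obtain y where y: "g (take n x) = Some y" by blast
    have d: "drop n x \<in> lists A" using x by (auto dest: in_set_dropD)
    have "g x = Some (y @ drop n x)" using morphismD(3)[OF gm y d] by simp
    moreover have "m \<le> length (y @ drop n x)" using x by simp
    ultimately show ?thesis using morphismD(2)[OF gm] by blast
  qed
  then show ?thesis by blast
qed

lemma tlep_comp:
  assumes A: "finite A" "A \<noteq> {}" and f: "f \<in> carrier (tlepRM_fin A)" and g: "g \<in> carrier (tlepRM_fin A)"
  shows "f \<circ>\<^sub>m g \<in> carrier (tlepRM_fin A)"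
proof -
  note iff = tlep_carrier_iff[OF A]
  obtain m where m: "\<And>x. x \<in> lists A \<Longrightarrow> m \<le> length x \<Longrightarrow> x \<in> dom f"
    using f iff by metis
  obtain n where n: "\<forall>x\<in>lists A. n \<le> length x \<longrightarrow> (\<exists>y\<in>lists A. g x = Some y \<and> m \<le> length y)"
    using eventually_long[OF A g] by blast
  have "x \<in> dom (f \<circ>\<^sub>m g)" if x: "x \<in> lists A" "n \<le> length x" for x
  proof -
    obtain y where y: "y \<in> lists A" "g x = Some y" "m \<le> length y" using n x by blast
    then obtain z where "f y = Some z" using m by blast
    with y show ?thesis by (auto simp: map_comp_def)
  qed
  moreover have "length y = length y'"
    if x: "(f \<circ>\<^sub>m g) x = Some y" "(f \<circ>\<^sub>m g) x' = Some y'" "length x = length x'" for x y x' y'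
  proof -
    obtain z z' where z: "g x = Some z" "f z = Some y" "g x' = Some z'" "f z' = Some y'"
      using x(1,2) by (auto simp: map_comp_Some_iff)
    then have "length z = length z'" using g x(3) unfolding iff by blast
    then show ?thesis using f z unfolding iff by blast
  qed
  ultimately show ?thesis using f g morphism_comp unfolding iff by blast
qed

lemma tfl_comp:
  assumes A: "finite A" "A \<noteq> {}" and f: "f \<in> carrier (tflRM_fin A)" and g: "g \<in> carrier (tflRM_fin A)"
  shows "f \<circ>\<^sub>m g \<in> carrier (tflRM_fin A)"
proof -
  note iff = tfl_carrier_iff[OF A]
  have fg: "f \<circ>\<^sub>m g \<in> carrier (tlepRM_fin A)" using tlep_comp[OF A] f g unfolding iff by blast
  have mor: "right_ideal_morphism A (f \<circ>\<^sub>m g)" and gm: "right_ideal_morphism A g"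
    using fg g unfolding iff tlep_carrier_iff[OF A] by blast+
  obtain m where m: "dom f = {w \<in> lists A. m \<le> length w}" using f unfolding iff by blast
  obtain n where n: "dom g = {w \<in> lists A. n \<le> length w}" using g unfolding iff by blast
  have len: "\<And>x y x' y'. g x = Some y \<Longrightarrow> g x' = Some y' \<Longrightarrow> length x = length x' \<Longrightarrow> length y = length y'"
    using g unfolding iff tlep_carrier_iff[OF A] by blast
  have same: "x' \<in> dom (f \<circ>\<^sub>m g)"
    if x: "x \<in> dom (f \<circ>\<^sub>m g)" "x' \<in> lists A" "length x = length x'" for x x'
  proof -
    obtain y where y: "g x = Some y" "y \<in> dom f"
      using x(1) by (auto simp: dom_def map_comp_Some_iff)
    have "x \<in> dom g" using y(1) by blast
    then have "x' \<in> dom g" using x(2,3) unfolding n by simp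
    then obtain y' where y': "g x' = Some y'" by blast
    have "y' \<in> dom f" using len[OF y(1) y' x(3)] y(2) morphismD(2)[OF gm y'] unfolding m by simp
    then show ?thesis using y' by (auto simp: dom_def map_comp_Some_iff)
  qed
  obtain N0 where N0: "\<And>x. x \<in> lists A \<Longrightarrow> N0 \<le> length x \<Longrightarrow> x \<in> dom (f \<circ>\<^sub>m g)"
    using fg unfolding tlep_carrier_iff[OF A] by blast
  obtain u where u: "u \<in> lists A" "length u = N0" using lists_extend[OF A(2)] by blast
  define N where "N = (LEAST l. \<exists>x\<in>dom (f \<circ>\<^sub>m g). length x = l)"
  have "\<exists>x\<in>dom (f \<circ>\<^sub>m g). length x = N0" using N0[OF u(1)] u(2) by blast
  then have "\<exists>x\<in>dom (f \<circ>\<^sub>m g). length x = N" unfolding N_def by (rule LeastI)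
  then obtain z where z: "z \<in> dom (f \<circ>\<^sub>m g)" "length z = N" by blast
  have "dom (f \<circ>\<^sub>m g) = {w \<in> lists A. N \<le> length w}"
  proof (intro Set.set_eqI iffI)
    fix x assume x: "x \<in> dom (f \<circ>\<^sub>m g)"
    then have "N \<le> length x" unfolding N_def by (intro Least_le) blast
    then show "x \<in> {w \<in> lists A. N \<le> length w}" using x morphismD(1)[OF mor] by blast
  next
    fix x assume "x \<in> {w \<in> lists A. N \<le> length w}"
    then have x: "x \<in> lists A" "N \<le> length x" by auto
    have t: "take N x \<in> dom (f \<circ>\<^sub>m g)"
      by (rule same[OF z(1)]) (use x z(2) in \<open>auto dest: in_set_takeD\<close>)
    have d: "drop N x \<in> lists A" using x by (auto dest: in_set_dropD)
    obtain y where "(f \<circ>\<^sub>m g) (take N x) = Some y" using t by blast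
    from morphismD(3)[OF mor this d] have "(f \<circ>\<^sub>m g) x = Some (y @ drop N x)" by simp
    then show "x \<in> dom (f \<circ>\<^sub>m g)" by blast
  qed
  then show ?thesis using fg unfolding iff by blast
qed

lemma one_carrier:
  assumes A: "finite A" "A \<noteq> {}"
  shows "Some |` lists A \<in> carrier (tlepRM_fin A)" "Some |` lists A \<in> carrier (tflRM_fin A)"
proof -
  have "right_ideal_morphism A (Some |` lists A)"
    by (rule morphismI) (auto simp: restrict_map_def split: if_splits)
  then show *: "Some |` lists A \<in> carrier (tlepRM_fin A)"
    by (auto simp: tlep_carrier_iff[OF A] restrict_map_def split: if_splits)
  have "dom (Some |` lists A) = {w \<in> lists A. 0 \<le> length w}" by auto
  with * show "Some |` lists A \<in> carrier (tflRM_fin A)" unfolding tfl_carrier_iff[OF A] by blast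
qed

lemma one_comp:
  assumes "right_ideal_morphism A f"
  shows "Some |` lists A \<circ>\<^sub>m f = f" "f \<circ>\<^sub>m Some |` lists A = f"
proof -
  show "Some |` lists A \<circ>\<^sub>m f = f"
  proof
    fix x show "(Some |` lists A \<circ>\<^sub>m f) x = f x"
      using morphismD(2)[OF assms, of x] by (cases "f x") (simp_all add: map_comp_def)
  qed
  show "f \<circ>\<^sub>m Some |` lists A = f"
  proof
    fix x show "(f \<circ>\<^sub>m Some |` lists A) x = f x"
      using morphismD(1)[OF assms, of x]
      by (cases "f x"; cases "x \<in> lists A") (simp_all add: map_comp_def restrict_map_def)
  qed
qed

lemma map_comp_assoc: "(f \<circ>\<^sub>m g) \<circ>\<^sub>m h = f \<circ>\<^sub>m (g \<circ>\<^sub>m h)"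
  by (auto simp: fun_eq_iff map_comp_def split: option.splits)

lemma monoid_tlepRM_fin:
  assumes A: "finite A" "A \<noteq> {}"
  shows "monoid (tlepRM_fin A)"
proof -
  have "right_ideal_morphism A f" if "f \<in> carrier (tlepRM_fin A)" for f
    using that tlep_carrier_iff[OF A] by blast
  moreover have "mult (tlepRM_fin A) = (\<circ>\<^sub>m)" "one (tlepRM_fin A) = Some |` lists A"
    by (simp_all add: tlepRM_fin_def)
  ultimately show ?thesis
    by (intro monoidI) (simp_all add: tlep_comp[OF A] one_carrier[OF A] one_comp map_comp_assoc)
qed

lemma monoid_tflRM_fin:
  assumes A: "finite A" "A \<noteq> {}"
  shows "monoid (tflRM_fin A)"
proof -
  have "right_ideal_morphism A f" if "f \<in> carrier (tflRM_fin A)" for f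
    using that tlep_carrier_iff[OF A] tfl_carrier_iff[OF A] by blast
  moreover have "mult (tflRM_fin A) = (\<circ>\<^sub>m)" "one (tflRM_fin A) = Some |` lists A"
    by (simp_all add: tflRM_fin_def)
  ultimately show ?thesis
    by (intro monoidI) (simp_all add: tfl_comp[OF A] one_carrier[OF A] one_comp map_comp_assoc)
qed

lemma fin_equiv_iff:
  assumes A: "finite A" "A \<noteq> {}"
    and f: "f \<in> carrier (tlepRM_fin A)" and g: "g \<in> carrier (tlepRM_fin A)"
  shows "(f, g) \<in> fin_equiv A \<longleftrightarrow> (\<exists>n. \<forall>x\<in>lists A. n \<le> length x \<longrightarrow> f x = g x)"
proof -
  have mf: "right_ideal_morphism A f" and mg: "right_ideal_morphism A g"
    using f g tlep_carrier_iff[OF A] by blast+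
  obtain m m' where m: "\<And>x. x \<in> lists A \<Longrightarrow> m \<le> length x \<Longrightarrow> x \<in> dom f"
    and m': "\<And>x. x \<in> lists A \<Longrightarrow> m' \<le> length x \<Longrightarrow> x \<in> dom g"
    using f g unfolding tlep_carrier_iff[OF A] by metis
  have "sym_diff (dom f) (dom g) \<subseteq> {x. set x \<subseteq> A \<and> length x \<le> max m m'}"
  proof
    fix x assume x: "x \<in> sym_diff (dom f) (dom g)"
    then have xA: "x \<in> lists A" using morphismD(1)[OF mf] morphismD(1)[OF mg] by blast
    have "\<not> (m \<le> length x \<and> m' \<le> length x)" using x m[OF xA] m'[OF xA] by blast
    then have "length x \<le> max m m'" by linarith
    with xA show "x \<in> {x. set x \<subseteq> A \<and> length x \<le> max m m'}" by auto
  qed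
  then have fin: "finite (sym_diff (dom f) (dom g))"
    by (rule finite_subset) (rule finite_lists_length_le[OF A(1)])
  have "(\<forall>x\<in>dom f \<inter> dom g. f x = g x) \<longleftrightarrow> (\<exists>n. \<forall>x\<in>lists A. n \<le> length x \<longrightarrow> f x = g x)"
  proof
    assume "\<forall>x\<in>dom f \<inter> dom g. f x = g x"
    then show "\<exists>n. \<forall>x\<in>lists A. n \<le> length x \<longrightarrow> f x = g x"
      by (intro exI[of _ "max m m'"]) (use m m' in auto)
  next
    assume "\<exists>n. \<forall>x\<in>lists A. n \<le> length x \<longrightarrow> f x = g x"
    then obtain n where n: "\<And>x. x \<in> lists A \<Longrightarrow> n \<le> length x \<Longrightarrow> f x = g x" by blast
    obtain u where u: "u \<in> lists A" "length u = n" using lists_extend[OF A(2)] by blast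
    show "\<forall>x\<in>dom f \<inter> dom g. f x = g x"
    proof
      fix x assume "x \<in> dom f \<inter> dom g"
      then obtain y z where yz: "f x = Some y" "g x = Some z" by blast
      have "f (x @ u) = g (x @ u)" using n[of "x @ u"] u morphismD(1)[OF mf yz(1)] by simp
      then show "f x = g x"
        using morphismD(3)[OF mf yz(1) u(1)] morphismD(3)[OF mg yz(2) u(1)] yz by simp
    qed
  qed
  then show ?thesis using f g fin by (simp add: fin_equiv_def)
qed

lemma monoid_congruence_fin_equiv:
  assumes A: "finite A" "A \<noteq> {}"
  shows "monoid_congruence (tlepRM_fin A) (fin_equiv A)"
proof -
  let ?C = "carrier (tlepRM_fin A)"
  have sub: "fin_equiv A \<subseteq> ?C \<times> ?C" by (auto simp: fin_equiv_def)
  have "equiv ?C (fin_equiv A)"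
  proof (rule equivI)
    show "trans (fin_equiv A)"
    proof (rule transI)
      fix f g h assume fg: "(f, g) \<in> fin_equiv A" and gh: "(g, h) \<in> fin_equiv A"
      then have c: "f \<in> ?C" "g \<in> ?C" "h \<in> ?C" using sub by blast+
      obtain n n' where "\<And>x. x \<in> lists A \<Longrightarrow> n \<le> length x \<Longrightarrow> f x = g x"
        and "\<And>x. x \<in> lists A \<Longrightarrow> n' \<le> length x \<Longrightarrow> g x = h x"
        using fg gh c fin_equiv_iff[OF A] by metis
      then have "\<forall>x\<in>lists A. max n n' \<le> length x \<longrightarrow> f x = h x" by simp
      then show "(f, h) \<in> fin_equiv A"
        unfolding fin_equiv_iff[OF A c(1,3)] by blast
    qed
  qed (auto simp: fin_equiv_def refl_on_def sym_def Un_commute)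
  moreover have "(f \<circ>\<^sub>m g, f' \<circ>\<^sub>m g') \<in> fin_equiv A"
    if ff: "(f, f') \<in> fin_equiv A" and gg: "(g, g') \<in> fin_equiv A" for f f' g g'
  proof -
    have c: "f \<in> ?C" "f' \<in> ?C" "g \<in> ?C" "g' \<in> ?C" using sub ff gg by blast+
    obtain n n' where n: "\<And>x. x \<in> lists A \<Longrightarrow> n \<le> length x \<Longrightarrow> f x = f' x"
      and n': "\<And>x. x \<in> lists A \<Longrightarrow> n' \<le> length x \<Longrightarrow> g x = g' x"
      using ff gg c fin_equiv_iff[OF A] by metis
    obtain l where l: "\<And>x. x \<in> lists A \<Longrightarrow> l \<le> length x \<Longrightarrow> \<exists>y\<in>lists A. g x = Some y \<and> n \<le> length y"
      using eventually_long[OF A c(3)] by metis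
    have "(f \<circ>\<^sub>m g) x = (f' \<circ>\<^sub>m g') x" if x: "x \<in> lists A" "max l n' \<le> length x" for x
    proof -
      obtain y where "y \<in> lists A" "g x = Some y" "n \<le> length y" using l[of x] x by auto
      moreover have "g x = g' x" using n' x by simp
      ultimately show ?thesis using n[of y] by (simp add: map_comp_def)
    qed
    then have "\<forall>x\<in>lists A. max l n' \<le> length x \<longrightarrow> (f \<circ>\<^sub>m g) x = (f' \<circ>\<^sub>m g') x" by blast
    then show ?thesis
      unfolding fin_equiv_iff[OF A tlep_comp[OF A c(1,3)] tlep_comp[OF A c(2,4)]] by blast
  qed
  moreover have "mult (tlepRM_fin A) = (\<circ>\<^sub>m)" by (simp add: tlepRM_fin_def)
  ultimately show ?thesis unfolding monoid_congruence_def by simp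
qed

lemma monoid_tlepM:
  assumes "finite A" "A \<noteq> {}"
  shows "monoid (tlepM A)"
  unfolding tlepM_def
  by (rule monoid_quotient_monoid[OF monoid_tlepRM_fin[OF assms] monoid_congruence_fin_equiv[OF assms]])

end

theory Submission
  imports Defs
begin

text \<open>A total length-equality preserving morphism acts on lengths: \<open>length (f x)\<close> depends only on
  \<open>length x\<close>. Forgetting everything about \<open>f\<close> except this action is compatible with composition, so
  the relation ``\<open>f x\<close> and \<open>g x\<close> have the same length for all sufficiently long \<open>x\<close>'' is a congruence
  (\<open>monoid_congruence_length_equiv\<close>). Comparing only long words makes it coarser than the
  relation \<open>fin_equiv\<close>, hence it passes to the quotient \<open>tlepM\<close>, and it restricts to
  the submonoid \<open>tflRM_fin\<close>.

  It lies strictly between the extreme congruences. Overwriting the first letter of a word by a fixed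
  letter \<open>a\<close> keeps all lengths, but differs from the identity on every word that starts with another
  letter; hence the relation is not equality, even modulo \<open>fin_equiv\<close>. Prepending \<open>a\<close>
  changes every length, hence the relation is not universal. All these witnesses have a domain code
  of fixed length, so they serve all three monoids at once.\<close>

section \<open>Transfer of congruences to quotients and submonoids\<close>

lemma not_congruence_simpleI:
  assumes "monoid_congruence M s" "(x, y) \<in> s" "x \<noteq> y"
    and "u \<in> carrier M" "v \<in> carrier M" "(u, v) \<notin> s"
  shows "\<not> congruence_simple M"
  using assms unfolding congruence_simple_def by blast

lemma monoid_congruence_restrict:
  assumes s: "monoid_congruence M s" and N: "monoid N"
    and sub: "carrier N \<subseteq> carrier M" and mult: "mult N = mult M"
  shows "monoid_congruence N (s \<inter> carrier N \<times> carrier N)"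
proof -
  have "equiv (carrier M) s" using s by (simp add: monoid_congruence_def)
  then have "equiv (carrier N) (s \<inter> carrier N \<times> carrier N)"
    using sub by (blast intro: equivI refl_onI symI transI elim: equivE
        dest: refl_onD symD transD)
  moreover have "(x \<otimes>\<^bsub>N\<^esub> y, x' \<otimes>\<^bsub>N\<^esub> y') \<in> s" if "(x, x') \<in> s" "(y, y') \<in> s" for x x' y y'
    using s that unfolding monoid_congruence_def mult by blast
  ultimately show ?thesis
    using monoid.m_closed[OF N] unfolding monoid_congruence_def by blast
qed

text \<open>One half of the correspondence between the congruences of \<open>M / r\<close> and those of \<open>M\<close> above \<open>r\<close>:
  a congruence strictly between \<open>r\<close> and the universal one descends to a nontrivial congruence.\<close>

lemma not_congruence_simple_quotient:
  assumes r: "monoid_congruence M r" and s: "monoid_congruence M s" and sub: "r \<subseteq> s"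
    and M: "monoid M"
    and xy: "(x, y) \<in> s" "(x, y) \<notin> r"
    and uv: "u \<in> carrier M" "v \<in> carrier M" "(u, v) \<notin> s"
  shows "\<not> congruence_simple (quotient_monoid M r)"
proof -
  have er: "equiv (carrier M) r" and es: "equiv (carrier M) s"
    using r s by (simp_all add: monoid_congruence_def)
  have sC: "s \<subseteq> carrier M \<times> carrier M" using es by (auto elim: equivE simp: equiv_type)
  define S where "S = {(r `` {f}, r `` {g}) |f g. (f, g) \<in> s}"
  \<comment> \<open>Since \<open>r \<subseteq> s\<close>, membership in \<open>S\<close> can be tested on any representatives.\<close>
  have S_iff: "(r `` {f}, r `` {g}) \<in> S \<longleftrightarrow> (f, g) \<in> s"
    if fg: "f \<in> carrier M" "g \<in> carrier M" for f g
  proof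
    assume "(r `` {f}, r `` {g}) \<in> S"
    then obtain f' g' where *: "r `` {f} = r `` {f'}" "r `` {g} = r `` {g'}" "(f', g') \<in> s"
      unfolding S_def by blast
    then have "(f, f') \<in> s" "(g', g) \<in> s"
      using sC fg sub eq_equiv_class_iff[OF er] by (metis SigmaD1 SigmaD2 subsetD)+
    with *(3) show "(f, g) \<in> s" using es by (meson equivE transD)
  qed (auto simp: S_def)
  have S_sub: "S \<subseteq> carrier M // r \<times> carrier M // r"
    unfolding S_def using sC by (auto intro: quotientI)
  have rep: "\<exists>f\<in>carrier M. X = r `` {f}" if "X \<in> carrier M // r" for X
    using that by (blast elim: quotientE)
  have "monoid_congruence (quotient_monoid M r) S"
    unfolding monoid_congruence_def
  proof (intro conjI allI impI)
    have "refl_on (carrier M // r) S"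
    proof (rule refl_onI)
      fix X assume "X \<in> carrier M // r"
      then obtain f where f: "f \<in> carrier M" "X = r `` {f}" using rep by blast
      have "(f, f) \<in> s" using es f(1) by (meson equivE refl_onD)
      then show "(X, X) \<in> S" using f S_iff by blast
    qed
    moreover have "sym S"
      unfolding S_def using es by (blast intro: symI elim: equivE dest: symD)
    moreover have "trans S"
    proof (rule transI)
      fix X Y Z assume XY: "(X, Y) \<in> S" and YZ: "(Y, Z) \<in> S"
      then have "X \<in> carrier M // r" "Y \<in> carrier M // r" "Z \<in> carrier M // r"
        using S_sub by blast+
      then obtain f g h where c: "f \<in> carrier M" "g \<in> carrier M" "h \<in> carrier M"
        and e: "X = r `` {f}" "Y = r `` {g}" "Z = r `` {h}"
        using rep by metis
      have "(f, g) \<in> s" "(g, h) \<in> s" using XY YZ S_iff c e by blast+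
      then have "(f, h) \<in> s" using es by (meson equivE transD)
      then show "(X, Z) \<in> S" using S_iff c e by blast
    qed
    ultimately show "equiv (carrier (quotient_monoid M r)) S"
      using S_sub by (simp add: equiv_def quotient_monoid_def)
  next
    fix X X' Y Y' assume "(X, X') \<in> S" "(Y, Y') \<in> S"
    then obtain f f' g g' where s': "(f, f') \<in> s" "(g, g') \<in> s"
      and e: "X = r `` {f}" "X' = r `` {f'}" "Y = r `` {g}" "Y' = r `` {g'}"
      unfolding S_def by blast
    have c: "f \<in> carrier M" "f' \<in> carrier M" "g \<in> carrier M" "g' \<in> carrier M"
      using s' sC by blast+
    have "(f \<otimes>\<^bsub>M\<^esub> g, f' \<otimes>\<^bsub>M\<^esub> g') \<in> s" using s s' unfolding monoid_congruence_def by blast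
    then show "(X \<otimes>\<^bsub>quotient_monoid M r\<^esub> Y, X' \<otimes>\<^bsub>quotient_monoid M r\<^esub> Y') \<in> S"
      unfolding e quotient_monoid_mult_class[OF r c(1,3)] quotient_monoid_mult_class[OF r c(2,4)]
      by (simp add: S_iff monoid.m_closed[OF M] c)
  qed
  moreover have "(r `` {x}, r `` {y}) \<in> S" using xy(1) by (auto simp: S_def)
  moreover have "r `` {x} \<noteq> r `` {y}"
    using xy sC eq_equiv_class_iff[OF er] by blast
  moreover have "r `` {u} \<in> carrier (quotient_monoid M r)" "r `` {v} \<in> carrier (quotient_monoid M r)"
    using uv by (simp_all add: quotient_monoid_def quotientI)
  moreover have "(r `` {u}, r `` {v}) \<notin> S" using S_iff uv by blast
  ultimately show ?thesis by (rule not_congruence_simpleI)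
qed

section \<open>Morphisms with eventually equal output lengths\<close>

definition length_equiv :: "'a set \<Rightarrow> (('a list \<rightharpoonup> 'a list) \<times> ('a list \<rightharpoonup> 'a list)) set" where
  "length_equiv A = {(f, g). f \<in> carrier (tlepRM_fin A) \<and> g \<in> carrier (tlepRM_fin A) \<and>
     (\<exists>n. \<forall>x\<in>lists A. n \<le> length x \<longrightarrow> map_option length (f x) = map_option length (g x))}"

lemma length_equivD:
  assumes "(f, g) \<in> length_equiv A"
  shows "\<exists>n. \<forall>x\<in>lists A. n \<le> length x \<longrightarrow> map_option length (f x) = map_option length (g x)"
  using assms by (simp add: length_equiv_def)

lemma fin_equiv_subset_length_equiv:
  assumes A: "finite A" "A \<noteq> {}"
  shows "fin_equiv A \<subseteq> length_equiv A"
proof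
  fix p assume p: "p \<in> fin_equiv A"
  obtain f g where fg: "p = (f, g)" by (cases p)
  have c: "f \<in> carrier (tlepRM_fin A)" "g \<in> carrier (tlepRM_fin A)"
    using p by (auto simp: fg fin_equiv_def)
  then obtain n where "\<forall>x\<in>lists A. n \<le> length x \<longrightarrow> f x = g x"
    using p fin_equiv_iff[OF A] fg by blast
  then have "\<forall>x\<in>lists A. n \<le> length x \<longrightarrow> map_option length (f x) = map_option length (g x)"
    by simp
  with c show "p \<in> length_equiv A" unfolding fg length_equiv_def by blast
qed

text \<open>Compatibility with products: for long \<open>x\<close>, both \<open>g x\<close> and \<open>g' x\<close> are long and of equal length;
  passing from \<open>f (g x)\<close> to \<open>f' (g x)\<close> keeps the length because \<open>f\<close> and \<open>f'\<close> are related, and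
  passing on to \<open>f' (g' x)\<close> keeps it because \<open>f'\<close> preserves length equality.\<close>

lemma monoid_congruence_length_equiv:
  assumes A: "finite A" "A \<noteq> {}"
  shows "monoid_congruence (tlepRM_fin A) (length_equiv A)"
proof -
  let ?C = "carrier (tlepRM_fin A)"
  have sub: "length_equiv A \<subseteq> ?C \<times> ?C" by (auto simp: length_equiv_def)
  have "equiv ?C (length_equiv A)"
  proof (rule equivI)
    show "trans (length_equiv A)"
    proof (rule transI)
      fix f g h assume fg: "(f, g) \<in> length_equiv A" and gh: "(g, h) \<in> length_equiv A"
      then obtain n n' where
        "\<And>x. x \<in> lists A \<Longrightarrow> n \<le> length x \<Longrightarrow> map_option length (f x) = map_option length (g x)"
        and "\<And>x. x \<in> lists A \<Longrightarrow> n' \<le> length x \<Longrightarrow> map_option length (g x) = map_option length (h x)"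
        using length_equivD[OF fg] length_equivD[OF gh] by blast
      then have "\<forall>x\<in>lists A. max n n' \<le> length x \<longrightarrow>
          map_option length (f x) = map_option length (h x)" by simp
      then show "(f, h) \<in> length_equiv A"
        using fg gh unfolding length_equiv_def by blast
    qed
    show "sym (length_equiv A)" by (rule symI) (auto simp: length_equiv_def eq_commute)
  qed (auto simp: length_equiv_def refl_on_def)
  moreover have "(f \<circ>\<^sub>m g, f' \<circ>\<^sub>m g') \<in> length_equiv A"
    if ff: "(f, f') \<in> length_equiv A" and gg: "(g, g') \<in> length_equiv A" for f f' g g'
  proof -
    have c: "f \<in> ?C" "f' \<in> ?C" "g \<in> ?C" "g' \<in> ?C" using sub ff gg by blast+
    obtain n n' where
      n: "\<And>x. x \<in> lists A \<Longrightarrow> n \<le> length x \<Longrightarrow> map_option length (f x) = map_option length (f' x)"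
      and n': "\<And>x. x \<in> lists A \<Longrightarrow> n' \<le> length x \<Longrightarrow> map_option length (g x) = map_option length (g' x)"
      using length_equivD[OF ff] length_equivD[OF gg] by blast
    obtain m where m: "\<And>x. x \<in> lists A \<Longrightarrow> m \<le> length x \<Longrightarrow> x \<in> dom f'"
      using c(2) unfolding tlep_carrier_iff[OF A] by blast
    have len: "\<And>x y x' y'. f' x = Some y \<Longrightarrow> f' x' = Some y' \<Longrightarrow> length x = length x' \<Longrightarrow>
        length y = length y'"
      using c(2) unfolding tlep_carrier_iff[OF A] by blast
    have g'm: "right_ideal_morphism A g'" using c(4) unfolding tlep_carrier_iff[OF A] by blast
    \<comment> \<open>Images of length at least \<open>n\<close> are compared by \<open>f\<close> and \<open>f'\<close>; length at least \<open>m\<close> puts them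
      in the domain of \<open>f'\<close>.\<close>
    obtain l where l: "\<And>x. x \<in> lists A \<Longrightarrow> l \<le> length x \<Longrightarrow>
        \<exists>y\<in>lists A. g x = Some y \<and> max n m \<le> length y"
      using eventually_long[OF A c(3), of "max n m"] by blast
    have "map_option length ((f \<circ>\<^sub>m g) x) = map_option length ((f' \<circ>\<^sub>m g') x)"
      if x: "x \<in> lists A" "max l n' \<le> length x" for x
    proof -
      obtain y where y: "y \<in> lists A" "g x = Some y" "n \<le> length y" "m \<le> length y"
        using l[of x] x by auto
      have "map_option length (g' x) = Some (length y)" using n'[of x] x y(2) by simp
      then obtain y' where y': "g' x = Some y'" "length y' = length y" by auto
      have "y' \<in> lists A" using morphismD(2)[OF g'm y'(1)] .
      then obtain z z' where z: "f' y = Some z" "f' y' = Some z'"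
        using m[of y] m[of y'] y y'(2) by auto
      have "length z = length z'" using len[OF z] y'(2) by simp
      then show ?thesis using n[of y] y y' z by (simp add: map_comp_def)
    qed
    then have "\<forall>x\<in>lists A. max l n' \<le> length x \<longrightarrow>
        map_option length ((f \<circ>\<^sub>m g) x) = map_option length ((f' \<circ>\<^sub>m g') x)" by blast
    then show ?thesis
      using tlep_comp[OF A c(1,3)] tlep_comp[OF A c(2,4)] unfolding length_equiv_def by blast
  qed
  moreover have "mult (tlepRM_fin A) = (\<circ>\<^sub>m)" by (simp add: tlepRM_fin_def)
  ultimately show ?thesis unfolding monoid_congruence_def by simp
qed

section \<open>Witnesses of nontriviality\<close>

definition prepend :: "'a set \<Rightarrow> 'a \<Rightarrow> 'a list \<rightharpoonup> 'a list" where
  "prepend A a = (\<lambda>x. if x \<in> lists A then Some (a # x) else None)"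

definition overwrite_head :: "'a set \<Rightarrow> 'a \<Rightarrow> 'a list \<rightharpoonup> 'a list" where
  "overwrite_head A a = (\<lambda>x. if x \<in> lists A \<and> x \<noteq> [] then Some (a # tl x) else None)"

lemma prepend_carrier:
  assumes A: "finite A" and a: "a \<in> A"
  shows "prepend A a \<in> carrier (tflRM_fin A)"
proof -
  have ne: "A \<noteq> {}" using a by blast
  have "right_ideal_morphism A (prepend A a)"
    by (rule morphismI) (auto simp: prepend_def a split: if_splits)
  moreover have "\<exists>n. \<forall>x\<in>lists A. n \<le> length x \<longrightarrow> x \<in> dom (prepend A a)"
    by (auto simp: prepend_def)
  moreover have "dom (prepend A a) = {w \<in> lists A. 0 \<le> length w}"
    by (auto simp: prepend_def split: if_splits)
  ultimately show ?thesis
    unfolding tfl_carrier_iff[OF A ne] tlep_carrier_iff[OF A ne]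
    by (auto simp: prepend_def split: if_splits)
qed

lemma overwrite_head_carrier:
  assumes A: "finite A" and a: "a \<in> A"
  shows "overwrite_head A a \<in> carrier (tflRM_fin A)"
proof -
  have ne: "A \<noteq> {}" using a by blast
  have "right_ideal_morphism A (overwrite_head A a)"
    by (rule morphismI) (auto simp: overwrite_head_def a neq_Nil_conv split: if_splits)
  moreover have dom: "dom (overwrite_head A a) = {w \<in> lists A. 1 \<le> length w}"
    by (auto simp: overwrite_head_def Suc_le_eq split: if_splits)
  moreover have "\<exists>n. \<forall>x\<in>lists A. n \<le> length x \<longrightarrow> x \<in> dom (overwrite_head A a)"
    unfolding dom by blast
  moreover have "\<forall>x y x' y'. overwrite_head A a x = Some y \<longrightarrow> overwrite_head A a x' = Some y' \<longrightarrow>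
      length x = length x' \<longrightarrow> length y = length y'"
    by (auto simp: overwrite_head_def split: if_splits)
  ultimately show ?thesis
    unfolding tfl_carrier_iff[OF A ne] tlep_carrier_iff[OF A ne] by blast
qed

lemma one_overwrite_head_length_equiv:
  assumes A: "finite A" and a: "a \<in> A"
  shows "(Some |` lists A, overwrite_head A a) \<in> length_equiv A"
proof -
  have ne: "A \<noteq> {}" using a by blast
  have "\<forall>x\<in>lists A. 1 \<le> length x \<longrightarrow>
      map_option length ((Some |` lists A) x) = map_option length (overwrite_head A a x)"
    by (auto simp: overwrite_head_def restrict_map_def Suc_le_eq)
  then show ?thesis
    using one_carrier(1)[OF A ne] overwrite_head_carrier[OF A a]
    unfolding length_equiv_def tfl_carrier_iff[OF A ne] by blast
qed

lemma one_overwrite_head_not_fin_equiv: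
  assumes A: "finite A" and a: "a \<in> A" and b: "b \<in> A" "b \<noteq> a"
  shows "(Some |` lists A, overwrite_head A a) \<notin> fin_equiv A"
proof
  assume "(Some |` lists A, overwrite_head A a) \<in> fin_equiv A"
  moreover have "[b] \<in> dom (Some |` lists A) \<inter> dom (overwrite_head A a)"
    using b(1) by (auto simp: overwrite_head_def)
  ultimately have "(Some |` lists A) [b] = overwrite_head A a [b]"
    unfolding fin_equiv_def by blast
  then show False using b by (simp add: overwrite_head_def)
qed

lemma one_prepend_not_length_equiv:
  assumes "A \<noteq> {}"
  shows "(Some |` lists A, prepend A a) \<notin> length_equiv A"
proof
  assume "(Some |` lists A, prepend A a) \<in> length_equiv A"
  then obtain n where n: "\<forall>x\<in>lists A. n \<le> length x \<longrightarrow>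
      map_option length ((Some |` lists A) x) = map_option length (prepend A a x)"
    unfolding length_equiv_def by blast
  obtain u where u: "u \<in> lists A" "length u = n" using lists_extend[OF assms] by blast
  then have "map_option length ((Some |` lists A) u) = map_option length (prepend A a u)"
    using n by blast
  then show False using u(1) by (simp add: prepend_def)
qed

theorem corollary7p7:
  fixes A :: "'a set" and k :: nat
  assumes "finite A" and "card A = k" and "k \<ge> 2"
  shows "\<not> congruence_simple (tlepM A) \<and>
         \<not> congruence_simple (tlepRM_fin A) \<and>
         \<not> congruence_simple (tflRM_fin A)"
proof -
  obtain a b where ab: "a \<in> A" "b \<in> A" "b \<noteq> a"
    using assms card_le_Suc0_iff_eq[of A] by fastforce
  have A: "finite A" "A \<noteq> {}" using assms(1) ab by auto
  let ?id = "Some |` lists A" and ?h = "overwrite_head A a" and ?p = "prepend A a"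
  note cong = monoid_congruence_length_equiv[OF A]
  note equiv = one_overwrite_head_length_equiv[OF A(1) ab(1)]
  note not_fin = one_overwrite_head_not_fin_equiv[OF A(1) ab]
  note not_equiv = one_prepend_not_length_equiv[OF A(2), of a]
  have sub: "carrier (tflRM_fin A) \<subseteq> carrier (tlepRM_fin A)"
    using tfl_carrier_iff[OF A] by blast
  have tfl: "?id \<in> carrier (tflRM_fin A)" "?h \<in> carrier (tflRM_fin A)" "?p \<in> carrier (tflRM_fin A)"
    using one_carrier(2)[OF A] overwrite_head_carrier[OF A(1) ab(1)] prepend_carrier[OF A(1) ab(1)]
    by blast+
  then have tlep: "?id \<in> carrier (tlepRM_fin A)" "?p \<in> carrier (tlepRM_fin A)"
    using sub by blast+
  have "(?id, ?id) \<in> fin_equiv A" using tlep(1) by (simp add: fin_equiv_def)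
  then have neq: "?id \<noteq> ?h" using not_fin by auto
  have "\<not> congruence_simple (tlepM A)"
    unfolding tlepM_def
    by (rule not_congruence_simple_quotient[OF monoid_congruence_fin_equiv[OF A] cong
          fin_equiv_subset_length_equiv[OF A] monoid_tlepRM_fin[OF A] equiv not_fin tlep not_equiv])
  moreover have "\<not> congruence_simple (tlepRM_fin A)"
    by (rule not_congruence_simpleI[OF cong equiv neq tlep not_equiv])
  moreover have "\<not> congruence_simple (tflRM_fin A)"
  proof (rule not_congruence_simpleI)
    show "monoid_congruence (tflRM_fin A)
        (length_equiv A \<inter> carrier (tflRM_fin A) \<times> carrier (tflRM_fin A))"
      by (rule monoid_congruence_restrict[OF cong monoid_tflRM_fin[OF A] sub])
        (simp add: tflRM_fin_def tlepRM_fin_def)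
    show "(?id, ?h) \<in> length_equiv A \<inter> carrier (tflRM_fin A) \<times> carrier (tflRM_fin A)"
      using equiv tfl by blast
    show "(?id, ?p) \<notin> length_equiv A \<inter> carrier (tflRM_fin A) \<times> carrier (tflRM_fin A)"
      using not_equiv by blast
  qed (use neq tfl in auto)
  ultimately show ?thesis by blast
qed

end
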